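(* Let $\mathcal C$ be a class of group homomorphisms and let $(F,\eta)$ be a $\mathcal C$-lifting functor such that $F(p)$ is an epimorphism for every $p\in\mathcal C$. Let $f\colon\Gamma\to G$ be a group homomorphism and let $p\colon\widetilde G\to G$ be an $f$-extension belonging to $\mathcal C$. Then every lifting $S\colon F(G)\to\widetilde G$ of $\eta$ along $p$ induces (by factoring through the quotient map $F(G)\to F_f(G)$) an epimorphism $$\overline S\colon F_f(G)\longrightarrow\operatorname{Im}\eta_{\widetilde G}.$$
   Context: Let $\mathbf{Grp}$ be the category of groups, $F\colon\mathbf{Grp}\to\mathbf{Grp}$ an endofunctor and $\eta\colon F\Rightarrow\mathrm{Id}_{\mathbf{Grp}}$ a natural transformation. For a class $\mathcal C$ of group homomorphisms, $(F,\eta)$ is a $\mathcal C$-lifting functor if for every $p\colon\widetilde G\to G$ in $\mathcal C$ there is a homomorphism $S\colon F(G)\to\widetilde G$ with $pS=\eta_G$ and $SF(p)=\eta_{\widetilde G}$; such an $S$ is called a lifting of $\eta$ along $p$. Put $H_F(G)=\ker\eta_G$. For a homomorphism $f\colon\Gamma\to G$ let $N_F(f)$ be the normal closure in $F(G)$ of $F(f)(H_F(\Gamma))$ (it is contained in $H_F(G)$), and put $F_f(G)=F(G)/N_F(f)$. An $f$-extension of $G$ is an epimorphism $p\colon\widetilde G\to G$ for which there is a homomorphism $\widetilde f\colon\Gamma\to\widetilde G$ with $p\widetilde f=f$. *)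

theory Defs
  imports "HOL-Algebra.Algebra"
begin

text \<open>
  A morphism \<open>G \<rightarrow> H\<close> of groups is a function that is \<open>undefined\<close> outside \<open>carrier G\<close>, so that
  equality of morphisms is equality of functions and composition is \<open>compose (carrier G)\<close>.
\<close>

definition grp_hom :: "('a, 'm) monoid_scheme \<Rightarrow> ('b, 'n) monoid_scheme \<Rightarrow> ('a \<Rightarrow> 'b) set"
  where "grp_hom G H = hom G H \<inter> extensional (carrier G)"

definition grp_epi :: "('a, 'm) monoid_scheme \<Rightarrow> ('b, 'n) monoid_scheme \<Rightarrow> ('a \<Rightarrow> 'b) set"
  where "grp_epi G H = epi G H \<inter> extensional (carrier G)"

text \<open>
  A class of group homomorphisms; the triple \<open>(A, B, p)\<close> stands for \<open>p : A \<rightarrow> B\<close>.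
\<close>

definition grp_hom_class :: "('a monoid \<times> 'a monoid \<times> ('a \<Rightarrow> 'a)) set \<Rightarrow> bool"
  where "grp_hom_class C \<longleftrightarrow> (\<forall>(A, B, p) \<in> C. group A \<and> group B \<and> p \<in> grp_hom A B)"

text \<open>
  HOL has no type containing all groups.  A functor is applied to all groups with carrier in an
  arbitrary type \<open>'a\<close> and may return groups with carrier in a second type \<open>'b\<close>: for \<open>'a = 'b\<close> this
  is literally an endofunctor of the category of groups over \<open>'a\<close>, and leaving \<open>'b\<close> free also
  covers functors that enlarge cardinalities (such as the free group on the power set of the
  carrier), which no infinite type \<open>'a\<close> alone could accommodate.
  \<open>Fm G H f\<close> is the value of the functor on the morphism \<open>f : G \<rightarrow> H\<close>.
\<close>

locale grp_functor =
  fixes Fo :: "'a monoid \<Rightarrow> 'b monoid"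
    and Fm :: "'a monoid \<Rightarrow> 'a monoid \<Rightarrow> ('a \<Rightarrow> 'a) \<Rightarrow> ('b \<Rightarrow> 'b)"
  assumes Fo_group: "group G \<Longrightarrow> group (Fo G)"
    and Fm_hom: "\<lbrakk>group G; group H; f \<in> grp_hom G H\<rbrakk> \<Longrightarrow> Fm G H f \<in> grp_hom (Fo G) (Fo H)"
    and Fm_id: "group G \<Longrightarrow> Fm G G (\<lambda>x\<in>carrier G. x) = (\<lambda>y\<in>carrier (Fo G). y)"
    and Fm_comp: "\<lbrakk>group G; group H; group K; f \<in> grp_hom G H; g \<in> grp_hom H K\<rbrakk>
      \<Longrightarrow> Fm G K (compose (carrier G) g f) = compose (carrier (Fo G)) (Fm H K g) (Fm G H f)"

text \<open>A functor \<open>F\<close> with a natural transformation \<open>\<eta> : F \<Rightarrow> Id\<close>.\<close>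

locale grp_functor_over_id = grp_functor Fo Fm
  for Fo :: "'a monoid \<Rightarrow> 'b monoid"
    and Fm :: "'a monoid \<Rightarrow> 'a monoid \<Rightarrow> ('a \<Rightarrow> 'a) \<Rightarrow> ('b \<Rightarrow> 'b)" +
  fixes \<eta> :: "'a monoid \<Rightarrow> 'b \<Rightarrow> 'a"
  assumes \<eta>_hom: "group G \<Longrightarrow> \<eta> G \<in> grp_hom (Fo G) G"
    and \<eta>_natural: "\<lbrakk>group G; group H; f \<in> grp_hom G H\<rbrakk>
      \<Longrightarrow> compose (carrier (Fo G)) (\<eta> H) (Fm G H f) = compose (carrier (Fo G)) f (\<eta> G)"

definition is_lifting ::
  "('a monoid \<Rightarrow> 'b monoid) \<Rightarrow> ('a monoid \<Rightarrow> 'a monoid \<Rightarrow> ('a \<Rightarrow> 'a) \<Rightarrow> ('b \<Rightarrow> 'b))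
    \<Rightarrow> ('a monoid \<Rightarrow> 'b \<Rightarrow> 'a) \<Rightarrow> 'a monoid \<Rightarrow> 'a monoid \<Rightarrow> ('a \<Rightarrow> 'a) \<Rightarrow> ('b \<Rightarrow> 'a) \<Rightarrow> bool"
  where "is_lifting Fo Fm \<eta> G' G p S \<longleftrightarrow>
    S \<in> grp_hom (Fo G) G' \<and>
    compose (carrier (Fo G)) p S = \<eta> G \<and>
    compose (carrier (Fo G')) S (Fm G' G p) = \<eta> G'"

locale lifting_functor = grp_functor_over_id Fo Fm \<eta>
  for C :: "('a monoid \<times> 'a monoid \<times> ('a \<Rightarrow> 'a)) set"
    and Fo :: "'a monoid \<Rightarrow> 'b monoid"
    and Fm :: "'a monoid \<Rightarrow> 'a monoid \<Rightarrow> ('a \<Rightarrow> 'a) \<Rightarrow> ('b \<Rightarrow> 'b)"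
    and \<eta> :: "'a monoid \<Rightarrow> 'b \<Rightarrow> 'a" +
  assumes lifting_exists: "(G', G, p) \<in> C \<Longrightarrow> \<exists>S. is_lifting Fo Fm \<eta> G' G p S"

definition normal_closure :: "('a, 'm) monoid_scheme \<Rightarrow> 'a set \<Rightarrow> 'a set"
  where "normal_closure G A = \<Inter>{N. N \<lhd> G \<and> A \<subseteq> N}"

definition H_F ::
  "('a monoid \<Rightarrow> 'b monoid) \<Rightarrow> ('a monoid \<Rightarrow> 'b \<Rightarrow> 'a) \<Rightarrow> 'a monoid \<Rightarrow> 'b set"
  where "H_F Fo \<eta> G = kernel (Fo G) G (\<eta> G)"

definition N_F ::
  "('a monoid \<Rightarrow> 'b monoid) \<Rightarrow> ('a monoid \<Rightarrow> 'a monoid \<Rightarrow> ('a \<Rightarrow> 'a) \<Rightarrow> ('b \<Rightarrow> 'b))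
    \<Rightarrow> ('a monoid \<Rightarrow> 'b \<Rightarrow> 'a) \<Rightarrow> 'a monoid \<Rightarrow> 'a monoid \<Rightarrow> ('a \<Rightarrow> 'a) \<Rightarrow> 'b set"
  where "N_F Fo Fm \<eta> \<Gamma> G f = normal_closure (Fo G) (Fm \<Gamma> G f ` H_F Fo \<eta> \<Gamma>)"

definition F_quot ::
  "('a monoid \<Rightarrow> 'b monoid) \<Rightarrow> ('a monoid \<Rightarrow> 'a monoid \<Rightarrow> ('a \<Rightarrow> 'a) \<Rightarrow> ('b \<Rightarrow> 'b))
    \<Rightarrow> ('a monoid \<Rightarrow> 'b \<Rightarrow> 'a) \<Rightarrow> 'a monoid \<Rightarrow> 'a monoid \<Rightarrow> ('a \<Rightarrow> 'a) \<Rightarrow> 'b set monoid"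
  where "F_quot Fo Fm \<eta> \<Gamma> G f = Fo G Mod N_F Fo Fm \<eta> \<Gamma> G f"

definition F_proj ::
  "('a monoid \<Rightarrow> 'b monoid) \<Rightarrow> ('a monoid \<Rightarrow> 'a monoid \<Rightarrow> ('a \<Rightarrow> 'a) \<Rightarrow> ('b \<Rightarrow> 'b))
    \<Rightarrow> ('a monoid \<Rightarrow> 'b \<Rightarrow> 'a) \<Rightarrow> 'a monoid \<Rightarrow> 'a monoid \<Rightarrow> ('a \<Rightarrow> 'a) \<Rightarrow> 'b \<Rightarrow> 'b set"
  where "F_proj Fo Fm \<eta> \<Gamma> G f = (\<lambda>x\<in>carrier (Fo G). N_F Fo Fm \<eta> \<Gamma> G f #>\<^bsub>Fo G\<^esub> x)"

definition is_extension ::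
  "'a monoid \<Rightarrow> 'a monoid \<Rightarrow> ('a \<Rightarrow> 'a) \<Rightarrow> 'a monoid \<Rightarrow> ('a \<Rightarrow> 'a) \<Rightarrow> bool"
  where "is_extension \<Gamma> G f G' p \<longleftrightarrow>
    p \<in> grp_epi G' G \<and> (\<exists>f' \<in> grp_hom \<Gamma> G'. compose (carrier \<Gamma>) p f' = f)"

definition im_group ::
  "('a, 'm) monoid_scheme \<Rightarrow> ('b, 'n) monoid_scheme \<Rightarrow> ('a \<Rightarrow> 'b) \<Rightarrow> ('b, 'n) monoid_scheme"
  where "im_group G H h = H\<lparr>carrier := h ` carrier G\<rparr>"

end

theory Submission
  imports Defs
begin

text \<open>
  Write \<open>f = p f'\<close> with \<open>f' : \<Gamma> \<rightarrow> G'\<close>.  Functoriality, the lifting equation \<open>S F(p) = \<eta>\<^sub>G\<^sub>'\<close> and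
  naturality of \<open>\<eta>\<close> give
    \<open>S F(f) = S F(p) F(f') = \<eta>\<^sub>G\<^sub>' F(f') = f' \<eta>\<^sub>\<Gamma>\<close>,
  so \<open>S\<close> kills \<open>F(f)(ker \<eta>\<^sub>\<Gamma>)\<close> (lemma \<open>lifting_kills_N_F\<close>), hence its normal closure, and
  factors uniquely through the quotient.  The image of the factorization is the image of \<open>S\<close>
  (lemma \<open>epi_factorization\<close>); as \<open>F(p)\<close> is onto, that is the image of \<open>S F(p) = \<eta>\<^sub>G\<^sub>'\<close>
  (lemma \<open>image_lifting\<close>).
\<close>

lemma compose_eqD: "compose A g f = h \<Longrightarrow> x \<in> A \<Longrightarrow> g (f x) = h x"
  by (metis compose_eq)

lemma normal_closure_normal:
  assumes "group G" and "A \<subseteq> carrier G"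
  shows "normal_closure G A \<lhd> G"
proof -
  interpret group G by fact
  \<comment> \<open>The whole group belongs to the family, so the intersection is not that of an empty family.\<close>
  have ne: "carrier G \<in> {N. N \<lhd> G \<and> A \<subseteq> N}"
    using assms(2) normal_self by simp
  have "subgroup (normal_closure G A) G"
    unfolding normal_closure_def
    by (rule subgroups_Inter) (use ne normal_imp_subgroup in blast)+
  moreover have "x \<otimes>\<^bsub>G\<^esub> h \<otimes>\<^bsub>G\<^esub> inv\<^bsub>G\<^esub> x \<in> normal_closure G A"
    if "x \<in> carrier G" "h \<in> normal_closure G A" for x h
    using that unfolding normal_closure_def by (auto simp: normal_inv_iff)
  ultimately show ?thesis
    by (simp add: normal_inv_iff)
qed

lemma normal_closure_subset: "N \<lhd> G \<Longrightarrow> A \<subseteq> N \<Longrightarrow> normal_closure G A \<subseteq> N"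
  unfolding normal_closure_def by blast

text \<open>
  The universal property of a quotient, with the target cut down to the image so that the
  factorization is onto.  Uniqueness holds because the coset map is onto and morphisms carry no
  values outside the carrier.
\<close>

lemma (in group_hom) epi_factorization:
  assumes N: "N \<lhd> G" "N \<subseteq> kernel G H h" and ext: "h \<in> extensional (carrier G)"
  shows "\<exists>!g. g \<in> grp_epi (G Mod N) (im_group G H h)
    \<and> compose (carrier G) g (\<lambda>x\<in>carrier G. N #> x) = h"
proof -
  obtain g where g: "g \<in> hom (G Mod N) H" and gh: "\<And>x. x \<in> carrier G \<Longrightarrow> g (N #> x) = h x"
    using FactGroup_universal_kernel[OF N] by blast
  let ?g = "restrict g (carrier (G Mod N))"
  interpret Q: group "G Mod N"
    using N(1) by (rule normal.factorgroup_is_group)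
  show ?thesis
  proof (rule ex1I[of _ ?g], intro conjI)
    have img: "g ` carrier (G Mod N) = h ` carrier G"
      unfolding carrier_FactGroup image_image using gh by (rule image_cong[OF refl])
    have hom: "?g \<in> hom (G Mod N) (im_group G H h)"
    proof (rule homI)
      fix u assume "u \<in> carrier (G Mod N)"
      then show "?g u \<in> carrier (im_group G H h)"
        using img unfolding im_group_def by auto
    next
      fix u v assume uv: "u \<in> carrier (G Mod N)" "v \<in> carrier (G Mod N)"
      then show "?g (u \<otimes>\<^bsub>G Mod N\<^esub> v) = ?g u \<otimes>\<^bsub>im_group G H h\<^esub> ?g v"
        using Q.m_closed[OF uv] Group.hom_mult[OF g uv] by (simp add: im_group_def)
    qed
    then show "?g \<in> grp_epi (G Mod N) (im_group G H h)"
      using img by (simp add: grp_epi_def epi_def im_group_def)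
    show "compose (carrier G) ?g (\<lambda>x\<in>carrier G. N #> x) = h"
      by (rule extensionalityI[OF compose_extensional ext])
        (simp add: compose_eq gh carrier_FactGroup)
  next
    fix k
    assume k: "k \<in> grp_epi (G Mod N) (im_group G H h)
      \<and> compose (carrier G) k (\<lambda>x\<in>carrier G. N #> x) = h"
    have kx: "k (N #> x) = h x" if "x \<in> carrier G" for x
      using compose_eqD[OF conjunct2[OF k] that] that by simp
    show "k = ?g"
    proof (rule extensionalityI)
      show "k \<in> extensional (carrier (G Mod N))"
        using k by (simp add: grp_epi_def)
      fix u assume "u \<in> carrier (G Mod N)"
      then show "k u = ?g u"
        by (auto simp: carrier_FactGroup kx gh)
    qed simp
  qed
qed

text \<open>
  Surjectivity of \<open>F(p)\<close> is what identifies the image of \<open>S\<close>: every element of \<open>F(G)\<close> is some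
  \<open>F(p)(y)\<close>, and \<open>S\<close> sends it to \<open>\<eta>\<^sub>G\<^sub>'(y)\<close>.
\<close>

lemma image_lifting:
  assumes "is_lifting Fo Fm \<eta> G' G p S" and "Fm G' G p \<in> grp_epi (Fo G') (Fo G)"
  shows "S ` carrier (Fo G) = \<eta> G' ` carrier (Fo G')"
proof -
  have "S ` carrier (Fo G) = (\<lambda>y. S (Fm G' G p y)) ` carrier (Fo G')"
    using assms(2) image_image[of S "Fm G' G p" "carrier (Fo G')"]
    by (simp add: grp_epi_def epi_def)
  also have "\<dots> = \<eta> G' ` carrier (Fo G')"
    using assms(1) by (intro image_cong refl) (auto simp: is_lifting_def intro: compose_eqD)
  finally show ?thesis .
qed

context grp_functor_over_id
begin

lemma \<eta>_naturalD:
  "\<lbrakk>group G; group H; f \<in> grp_hom G H; x \<in> carrier (Fo G)\<rbrakk> \<Longrightarrow> \<eta> H (Fm G H f x) = f (\<eta> G x)"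
  using compose_eqD[OF \<eta>_natural, of G H f x] by (simp add: compose_eq)

lemma Fm_H_F_subset_carrier:
  assumes "group \<Gamma>" "group G" "f \<in> grp_hom \<Gamma> G"
  shows "Fm \<Gamma> G f ` H_F Fo \<eta> \<Gamma> \<subseteq> carrier (Fo G)"
  using Fm_hom[OF assms] by (auto simp: grp_hom_def H_F_def kernel_def intro: hom_in_carrier)

text \<open>
  Since \<open>f = p f'\<close>, the map \<open>S F(f)\<close> equals \<open>f' \<eta>\<^sub>\<Gamma>\<close>, which is trivial on the kernel of
  \<open>\<eta>\<^sub>\<Gamma>\<close>; and the kernel of \<open>S\<close>, being normal, then contains the normal closure as well.
\<close>

lemma lifting_kills_N_F:
  assumes grp: "group \<Gamma>" "group G" "group G'"
    and p: "p \<in> grp_hom G' G" and f': "f' \<in> grp_hom \<Gamma> G'"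
    and lift: "is_lifting Fo Fm \<eta> G' G p S"
  shows "N_F Fo Fm \<eta> \<Gamma> G (compose (carrier \<Gamma>) p f') \<subseteq> kernel (Fo G) G' S"
  unfolding N_F_def
proof (rule normal_closure_subset)
  let ?f = "compose (carrier \<Gamma>) p f'"
  have S: "S \<in> hom (Fo G) G'"
    and SFp: "compose (carrier (Fo G')) S (Fm G' G p) = \<eta> G'"
    using lift by (auto simp: is_lifting_def grp_hom_def)
  interpret S: group_hom "Fo G" G' S
    using S grp Fo_group by (simp add: group_hom_def group_hom_axioms_def)
  show "kernel (Fo G) G' S \<lhd> Fo G"
    by (rule S.normal_kernel)
  have f: "?f \<in> grp_hom \<Gamma> G"
    using p f' monoid.m_closed[OF group.is_monoid[OF grp(1)]]
    by (auto simp: grp_hom_def hom_def compose_def Pi_iff)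
  show "Fm \<Gamma> G ?f ` H_F Fo \<eta> \<Gamma> \<subseteq> kernel (Fo G) G' S"
  proof
    fix y assume "y \<in> Fm \<Gamma> G ?f ` H_F Fo \<eta> \<Gamma>"
    then obtain x where x: "x \<in> carrier (Fo \<Gamma>)" "\<eta> \<Gamma> x = \<one>\<^bsub>\<Gamma>\<^esub>"
      and y: "y = Fm \<Gamma> G ?f x" and y_in: "y \<in> carrier (Fo G)"
      using Fm_H_F_subset_carrier[OF grp(1,2) f] by (auto simp: H_F_def kernel_def)
    have Fx: "Fm \<Gamma> G' f' x \<in> carrier (Fo G')"
      using Fm_hom[OF grp(1,3) f'] x(1) by (auto simp: grp_hom_def intro: hom_in_carrier)
    have "S y = S (Fm G' G p (Fm \<Gamma> G' f' x))"
      using Fm_comp[OF grp(1,3,2) f' p] x(1) y by (simp add: compose_eq)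
    also have "\<dots> = \<eta> G' (Fm \<Gamma> G' f' x)"
      using compose_eqD[OF SFp Fx] .
    also have "\<dots> = f' (\<one>\<^bsub>\<Gamma>\<^esub>)"
      using \<eta>_naturalD[OF grp(1,3) f' x(1)] x(2) by simp
    also have "\<dots> = \<one>\<^bsub>G'\<^esub>"
      using hom_one[of f' \<Gamma> G'] f' grp by (simp add: grp_hom_def)
    finally show "y \<in> kernel (Fo G) G' S"
      using y_in by (simp add: kernel_def)
  qed
qed

end

theorem theorem2p5:
  fixes C :: "('a monoid \<times> 'a monoid \<times> ('a \<Rightarrow> 'a)) set"
    and Fo :: "'a monoid \<Rightarrow> 'b monoid"
    and Fm :: "'a monoid \<Rightarrow> 'a monoid \<Rightarrow> ('a \<Rightarrow> 'a) \<Rightarrow> ('b \<Rightarrow> 'b)"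
    and \<eta> :: "'a monoid \<Rightarrow> 'b \<Rightarrow> 'a"
    and \<Gamma> G G' :: "'a monoid"
    and f p :: "'a \<Rightarrow> 'a"
    and S :: "'b \<Rightarrow> 'a"
  assumes "grp_hom_class C"
    and "lifting_functor C Fo Fm \<eta>"
    and "\<And>A B q. (A, B, q) \<in> C \<Longrightarrow> Fm A B q \<in> grp_epi (Fo A) (Fo B)"
    and "group \<Gamma>" and "group G" and "group G'"
    and "f \<in> grp_hom \<Gamma> G"
    and "is_extension \<Gamma> G f G' p"
    and "(G', G, p) \<in> C"
    and "is_lifting Fo Fm \<eta> G' G p S"
  shows "\<exists>!Sbar. Sbar \<in> grp_epi (F_quot Fo Fm \<eta> \<Gamma> G f) (im_group (Fo G') G' (\<eta> G'))
    \<and> compose (carrier (Fo G)) Sbar (F_proj Fo Fm \<eta> \<Gamma> G f) = S"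
proof -
  interpret lifting_functor C Fo Fm \<eta>
    by fact
  note lift = \<open>is_lifting Fo Fm \<eta> G' G p S\<close>
  have S: "S \<in> hom (Fo G) G'" "S \<in> extensional (carrier (Fo G))"
    using lift by (auto simp: is_lifting_def grp_hom_def)
  interpret S: group_hom "Fo G" G' S
    using S(1) \<open>group G\<close> \<open>group G'\<close> Fo_group by (simp add: group_hom_def group_hom_axioms_def)
  obtain f' where f': "f' \<in> grp_hom \<Gamma> G'" "compose (carrier \<Gamma>) p f' = f"
    and p: "p \<in> grp_hom G' G"
    using \<open>is_extension \<Gamma> G f G' p\<close>
    by (auto simp: is_extension_def grp_epi_def grp_hom_def epi_def)
  have "N_F Fo Fm \<eta> \<Gamma> G f \<lhd> Fo G"
    unfolding N_F_def
    using Fm_H_F_subset_carrier[OF \<open>group \<Gamma>\<close> \<open>group G\<close> \<open>f \<in> grp_hom \<Gamma> G\<close>]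
    by (intro normal_closure_normal Fo_group \<open>group G\<close>)
  moreover have "N_F Fo Fm \<eta> \<Gamma> G f \<subseteq> kernel (Fo G) G' S"
    using lifting_kills_N_F[OF \<open>group \<Gamma>\<close> \<open>group G\<close> \<open>group G'\<close> p f'(1) lift] f'(2) by simp
  moreover have "im_group (Fo G') G' (\<eta> G') = im_group (Fo G) G' S"
    using image_lifting lift assms(3) \<open>(G', G, p) \<in> C\<close> by (metis im_group_def)
  ultimately show ?thesis
    using S.epi_factorization[OF _ _ S(2)] by (simp add: F_quot_def F_proj_def)
qed

end
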